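(* Let $\Theta\subset\mathbb R$ be the parameter space of a parametric family $\{P_\theta:\theta\in\Theta\}$, and let $\mathcal P(\Theta)$ be the collection of all probability distributions (priors) on $\Theta$. Then $$\mathsf{TotRegretComp}'_n(\Theta)\ \ge\ \mathsf{TotRegretComp}_n(\Theta)\ \ge\ \mathsf{TotRegret}_n(\mathcal P(\Theta)).$$
   Context: $\{P_\theta:\theta\in\Theta\subset\mathbb R\}$ is a parametric family with bi-measurable densities $f_\theta(y)$ with respect to a common dominating measure. Conditioned on parameters $\theta^n=(\theta_1,\dots,\theta_n)$, the observations $Y_1,\dots,Y_n$ are independent with $Y_i\sim P_{\theta_i}$. $\|\cdot\|$ is the Euclidean norm. For a prior $G$ on $\Theta$: $\mathrm{mmse}(G)=\inf_{\hat\theta}\mathbb E_G[(\hat\theta(Y)-\theta)^2]$ with $\theta\sim G$, $Y\mid\theta\sim P_\theta$. Empirical Bayes regret: for a class $\mathcal G$ of priors, $$\mathsf{TotRegret}_n(\mathcal G)=\inf_{\hat\theta^n}\sup_{G\in\mathcal G}\{\mathbb E_G[\|\hat\theta^n(Y^n)-\theta^n\|^2]-n\,\mathrm{mmse}(G)\},$$ where under $\mathbb E_G$ the $\theta_i$ are i.i.d. from $G$, and the infimum is over all estimators that are functions of $Y^n$. Compound regrets: here $\theta^n\in\Theta^n$ is deterministic, and $G_{\theta^n}=\frac1n\sum_{i=1}^n\delta_{\theta_i}$ is its empirical distribution. Define $$\mathsf{TotRegretComp}_n(\Theta)=\inf_{\hat\theta^n}\sup_{\theta^n\in\Theta^n}\{\mathbb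 E[\|\hat\theta^n-\theta^n\|^2]-n\,\mathrm{mmse}(G_{\theta^n})\},$$ $$\mathsf{TotRegretComp}'_n(\Theta)=\inf_{\hat\theta^n}\sup_{\theta^n\in\Theta^n}\{\mathbb E[\|\hat\theta^n-\theta^n\|^2]-R_{\mathsf{oracle}}(G_{\theta^n})\},$$ where $$R_{\mathsf{oracle}}(G_{\theta^n})=\inf_f\sup_{\sigma\in S_n}\mathbb E_{\sigma\theta^n}[\|\sigma\theta^n-f(Y^n)\|^2],$$ $S_n$ is the group of permutations of $\{1,\dots,n\}$, $\sigma\theta^n=(\theta_{\sigma(1)},\dots,\theta_{\sigma(n)})$, $\mathbb E_{\sigma\theta^n}$ is expectation when the parameter vector is $\sigma\theta^n$, and the infimum is over all measurable $\mathbb R^n$-valued functions $f$ of $Y^n$. *)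

theory Defs
  imports "HOL-Probability.Probability" "HOL-Combinatorics.Permutations"
begin

text \<open>
  The sample space is \<open>\<mu>\<close>, whose measure dominates the family. The set \<open>\<Theta>\<close> need not be Borel: it
  carries the trace of the Borel sets of the real line. As usual for a dominated family, \<open>\<mu>\<close> is
  sigma-finite; together with joint measurability this makes \<open>P\<close> a Markov kernel.
\<close>

locale parametric_family = sigma_finite_measure \<mu>
  for \<mu> :: "'y measure" +
  fixes \<Theta> :: "real set"
    and P :: "real \<Rightarrow> 'y measure"
    and f :: "real \<Rightarrow> 'y \<Rightarrow> ennreal"
  assumes bimeasurable: "case_prod f \<in> borel_measurable (restrict_space borel \<Theta> \<Otimes>\<^sub>M \<mu>)"
    and density: "\<And>\<theta>. \<theta> \<in> \<Theta> \<Longrightarrow> P \<theta> = density \<mu> (f \<theta>)"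
    and prob: "\<And>\<theta>. \<theta> \<in> \<Theta> \<Longrightarrow> prob_space (P \<theta>)"

definition priors :: "real set \<Rightarrow> real measure set" where
  "priors \<Theta> = {G. prob_space G \<and> sets G = sets (restrict_space borel \<Theta>)}"

text \<open>The minimal mean square error. In \<open>mmse\<close> and below, \<open>\<mu>\<close> serves only as the measurable
  space of a single observation.\<close>

definition mmse :: "'y measure \<Rightarrow> (real \<Rightarrow> 'y measure) \<Rightarrow> real measure \<Rightarrow> ennreal" where
  "mmse \<mu> P G =
     (INF t \<in> borel_measurable \<mu>. \<integral>\<^sup>+\<theta>. (\<integral>\<^sup>+y. ennreal ((t y - \<theta>)\<^sup>2) \<partial>P \<theta>) \<partial>G)"

text \<open>Vectors of length \<open>n\<close> (parameters, observations, estimates) are functions on \<open>{..<n}\<close>;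
  the Euclidean norm is \<^const>\<open>L2_set\<close>.\<close>

definition estimators :: "'y measure \<Rightarrow> nat \<Rightarrow> ((nat \<Rightarrow> 'y) \<Rightarrow> (nat \<Rightarrow> real)) set" where
  "estimators \<mu> n = (\<Pi>\<^sub>M i\<in>{..<n}. \<mu>) \<rightarrow>\<^sub>M (\<Pi>\<^sub>M i\<in>{..<n}. borel)"

definition risk ::
    "(real \<Rightarrow> 'y measure) \<Rightarrow> nat \<Rightarrow> (nat \<Rightarrow> real) \<Rightarrow> ((nat \<Rightarrow> 'y) \<Rightarrow> (nat \<Rightarrow> real)) \<Rightarrow> ennreal" where
  "risk P n \<theta> t =
     (\<integral>\<^sup>+y. ennreal ((L2_set (\<lambda>i. t y i - \<theta> i) {..<n})\<^sup>2) \<partial>(\<Pi>\<^sub>M i\<in>{..<n}. P (\<theta> i)))"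

definition bayes_risk ::
    "(real \<Rightarrow> 'y measure) \<Rightarrow> nat \<Rightarrow> real measure \<Rightarrow> ((nat \<Rightarrow> 'y) \<Rightarrow> (nat \<Rightarrow> real)) \<Rightarrow> ennreal" where
  "bayes_risk P n G t = (\<integral>\<^sup>+\<theta>. risk P n \<theta> t \<partial>(\<Pi>\<^sub>M i\<in>{..<n}. G))"

text \<open>
  Regrets are extended reals. For a prior with infinite \<^const>\<open>mmse\<close> every estimator has infinite
  Bayes risk, and the difference below is \<open>\<infinity> - \<infinity>\<close>, which is \<open>\<infinity>\<close> in type \<^typ>\<open>ereal\<close>. No prior is
  excluded from the supremum, and \<open>tot_regret\<close> is at least as large as under any other convention.
\<close>

definition tot_regret ::
    "'y measure \<Rightarrow> (real \<Rightarrow> 'y measure) \<Rightarrow> nat \<Rightarrow> real measure set \<Rightarrow> ereal" where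
  "tot_regret \<mu> P n \<G> =
     (INF t \<in> estimators \<mu> n. SUP G \<in> \<G>.
        enn2ereal (bayes_risk P n G t) - enn2ereal (of_nat n * mmse \<mu> P G))"

definition empirical :: "real set \<Rightarrow> nat \<Rightarrow> (nat \<Rightarrow> real) \<Rightarrow> real measure" where
  "empirical \<Theta> n \<theta> = distr (uniform_count_measure {..<n}) (restrict_space borel \<Theta>) \<theta>"

definition tot_regret_comp ::
    "'y measure \<Rightarrow> (real \<Rightarrow> 'y measure) \<Rightarrow> nat \<Rightarrow> real set \<Rightarrow> ereal" where
  "tot_regret_comp \<mu> P n \<Theta> =
     (INF t \<in> estimators \<mu> n. SUP \<theta> \<in> {..<n} \<rightarrow>\<^sub>E \<Theta>.
        enn2ereal (risk P n \<theta> t) - enn2ereal (of_nat n * mmse \<mu> P (empirical \<Theta> n \<theta>)))"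

text \<open>The oracle risk depends on \<open>\<theta>\<close> only through its orbit under permutations, that is, through
  its empirical distribution.\<close>

definition oracle_risk :: "'y measure \<Rightarrow> (real \<Rightarrow> 'y measure) \<Rightarrow> nat \<Rightarrow> (nat \<Rightarrow> real) \<Rightarrow> ennreal" where
  "oracle_risk \<mu> P n \<theta> =
     (INF t \<in> estimators \<mu> n. SUP \<sigma> \<in> {\<sigma>. \<sigma> permutes {..<n}}. risk P n (\<theta> \<circ> \<sigma>) t)"

definition tot_regret_comp' ::
    "'y measure \<Rightarrow> (real \<Rightarrow> 'y measure) \<Rightarrow> nat \<Rightarrow> real set \<Rightarrow> ereal" where
  "tot_regret_comp' \<mu> P n \<Theta> =
     (INF t \<in> estimators \<mu> n. SUP \<theta> \<in> {..<n} \<rightarrow>\<^sub>E \<Theta>.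
        enn2ereal (risk P n \<theta> t) - enn2ereal (oracle_risk \<mu> P n \<theta>))"

lemma measurable_uniform_count_measure:
  assumes "\<theta> \<in> {..<n} \<rightarrow>\<^sub>E \<Theta>"
  shows "\<theta> \<in> uniform_count_measure {..<n} \<rightarrow>\<^sub>M restrict_space borel \<Theta>"
  using assms
  by (auto simp: measurable_def space_uniform_count_measure sets_uniform_count_measure
      space_restrict_space)

lemma empirical_in_priors:
  assumes "\<theta> \<in> {..<n} \<rightarrow>\<^sub>E \<Theta>" and "n \<ge> 1"
  shows "empirical \<Theta> n \<theta> \<in> priors \<Theta>"
proof -
  have "prob_space (uniform_count_measure {..<n})"
    using assms(2) by (intro prob_space_uniform_count_measure) (auto simp: lessThan_empty_iff)
  then show ?thesis
    using measurable_uniform_count_measure[OF assms(1)]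
    by (auto simp: priors_def empirical_def intro!: prob_space.prob_space_distr)
qed

lemma emeasure_empirical:
  assumes "\<theta> \<in> {..<n} \<rightarrow>\<^sub>E \<Theta>" and "A \<in> sets (restrict_space borel \<Theta>)"
  shows "emeasure (empirical \<Theta> n \<theta>) A = ennreal (real (card {i\<in>{..<n}. \<theta> i \<in> A}) / real n)"
proof -
  have "\<theta> -` A \<inter> {..<n} = {i\<in>{..<n}. \<theta> i \<in> A}" by auto
  then show ?thesis
    using measurable_uniform_count_measure[OF assms(1)] assms(2)
    by (simp add: empirical_def emeasure_distr space_uniform_count_measure
        emeasure_uniform_count_measure[OF finite_lessThan] subset_iff)
qed

end

theory Submission
  imports Defs
begin

text \<open>
  Write \<open>e\<^sub>s(\<theta>)\<close> for the risk at \<open>\<theta>\<close> of a one-observation estimator \<open>s\<close>. Since \<open>G\<^bsub>\<theta>\<^esub>\<close> is the empirical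
  distribution, \<open>n \<cdot> mmse(G\<^bsub>\<theta>\<^esub>)\<close> is the infimum over \<open>s\<close> of \<open>\<Sum>i<n. e\<^sub>s(\<theta> i)\<close>. This sum is also the risk of
  the estimator that applies \<open>s\<close> to each coordinate, and that risk is invariant under permutations
  of \<open>\<theta>\<close>. Hence the oracle risk is at most \<open>n \<cdot> mmse(G\<^bsub>\<theta>\<^esub>)\<close> (\<open>oracle_risk_le_mmse\<close>), which gives the
  first inequality estimator by estimator.

  For the second inequality, fix an estimator \<open>t\<close> whose worst compound regret is a real number \<open>r\<close>.
  Then the risk of \<open>t\<close> at \<open>\<theta>\<close> is at most \<open>r + (\<Sum>i<n. e\<^sub>s(\<theta> i))\<close> for all \<open>\<theta>\<close> and \<open>s\<close>. Integrating over i.i.d.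
  parameters from \<open>G\<close> and then minimising over \<open>s\<close> gives a Bayes risk of at most \<open>r + n \<cdot> mmse(G)\<close>
  (\<open>bayes_risk_le\<close>). This is the required bound on the regret of \<open>t\<close> under \<open>G\<close>, provided that \<open>mmse(G)\<close> is
  finite.

  Priors with infinite \<open>mmse\<close> have infinite regret, so the remaining point is that none exist once
  some \<open>t\<close> has finite worst compound regret (\<open>mmse_finite\<close>). Consider parameter vectors
  \<open>(a, \<dots>, a, b)\<close> and the last coordinate \<open>v\<close> of \<open>t\<close>, viewed as an estimator of \<open>b\<close> from the last
  observation that uses the others, drawn from \<open>P a\<close>, as external randomness. With all parameters
  equal to \<open>a\<close> the oracle makes no error, so \<open>v\<close> has risk at most \<open>r\<close> at \<open>a\<close>. At \<open>b\<close> its risk is at most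
  \<open>r + (n - 1) \<cdot> e\<^sub>s(a) + e\<^sub>s(b)\<close> for every \<open>s\<close>. Take for \<open>s\<close> the perturbation of \<open>v\<close> that moves a small
  fraction of the way towards \<open>b\<close> where \<open>f b \<ge> f a\<close>: what it gains at \<open>b\<close> is of first order in that
  fraction, what it adds at \<open>a\<close> apart from a multiple of \<open>r\<close> is of second order. The comparison therefore bounds
  \<open>(b - a)\<^sup>2 \<cdot> P a {f b \<ge> f a}\<close> by a multiple of \<open>r\<close> (\<open>perturbation_bound\<close>, \<open>overlap_bound\<close>): finite
  regret forces distant parameters to be well separated by a single observation. Now take for \<open>s\<close>
  the likelihood ratio test between \<open>a\<close> and \<open>b\<close>. It follows that the risk of \<open>v\<close> at \<open>b\<close> is bounded
  uniformly in \<open>b\<close>, and \<open>v\<close> bounds \<open>mmse(G)\<close> for every \<open>G\<close>.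
\<close>

section \<open>Risk of one-observation estimators\<close>

definition point_risk :: "(real \<Rightarrow> 'y measure) \<Rightarrow> ('y \<Rightarrow> real) \<Rightarrow> real \<Rightarrow> ennreal" where
  "point_risk P s \<theta> = (\<integral>\<^sup>+y. ennreal ((s y - \<theta>)\<^sup>2) \<partial>P \<theta>)"

lemma mmse_le:
  assumes "s \<in> borel_measurable \<mu>"
  shows "mmse \<mu> P G \<le> (\<integral>\<^sup>+\<theta>. point_risk P s \<theta> \<partial>G)"
  using assms unfolding mmse_def point_risk_def by (rule INF_lower)

text \<open>
  Together with \<open>mmse_le\<close>, this makes \<^const>\<open>mmse\<close> accessible through \<^const>\<open>point_risk\<close> alone. The hypothesis
  \<open>n \<ge> 1\<close> allows division by \<open>n\<close>, so the factor can be pulled out of the infimum.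
\<close>

lemma le_mult_mmse:
  fixes c :: ennreal
  assumes "n \<ge> 1"
    and "\<And>s. s \<in> borel_measurable \<mu> \<Longrightarrow> c \<le> of_nat n * (\<integral>\<^sup>+\<theta>. point_risk P s \<theta> \<partial>G)"
  shows "c \<le> of_nat n * mmse \<mu> P G"
proof -
  have n: "of_nat n \<noteq> (0::ennreal)" "of_nat n \<noteq> (\<top>::ennreal)"
    using assms(1) by auto
  have "c / of_nat n \<le> mmse \<mu> P G"
    unfolding mmse_def
  proof (rule INF_greatest)
    fix s :: "'a \<Rightarrow> real" assume s: "s \<in> borel_measurable \<mu>"
    have "c / of_nat n \<le> of_nat n * (\<integral>\<^sup>+\<theta>. point_risk P s \<theta> \<partial>G) / of_nat n"
      by (rule divide_right_mono_ennreal) (rule assms(2)[OF s])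
    also have "\<dots> = (\<integral>\<^sup>+\<theta>. point_risk P s \<theta> \<partial>G)"
      using n by (simp add: mult.commute[of "of_nat n"] ennreal_mult_divide_eq)
    finally show "c / of_nat n \<le> (\<integral>\<^sup>+\<theta>. (\<integral>\<^sup>+y. ennreal ((s y - \<theta>)\<^sup>2) \<partial>P \<theta>) \<partial>G)"
      unfolding point_risk_def .
  qed
  then have "of_nat n * (c / of_nat n) \<le> of_nat n * mmse \<mu> P G"
    by (rule mult_left_mono) simp
  moreover have "of_nat n * (c / of_nat n) = c"
    using n by (simp add: ennreal_times_divide mult.commute[of "of_nat n"] ennreal_mult_divide_eq)
  ultimately show ?thesis by simp
qed

context parametric_family
begin

lemma sets_P [simp]: "\<theta> \<in> \<Theta> \<Longrightarrow> sets (P \<theta>) = sets \<mu>"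
  by (simp add: density)

lemma density_measurable:
  assumes "\<theta> \<in> \<Theta>"
  shows "f \<theta> \<in> borel_measurable \<mu>"
proof -
  have "(\<lambda>y. (\<theta>, y)) \<in> \<mu> \<rightarrow>\<^sub>M restrict_space borel \<Theta> \<Otimes>\<^sub>M \<mu>"
    using assms by (intro measurable_Pair1') (simp add: space_restrict_space)
  from measurable_compose[OF this bimeasurable] show ?thesis by simp
qed

lemma nn_integral_P:
  assumes "\<theta> \<in> \<Theta>" "h \<in> borel_measurable \<mu>"
  shows "(\<integral>\<^sup>+y. h y \<partial>P \<theta>) = (\<integral>\<^sup>+y. f \<theta> y * h y \<partial>\<mu>)"
  using assms density_measurable[OF assms(1)] by (simp add: density nn_integral_density)

lemma measurable_P_integral:
  assumes h: "case_prod h \<in> borel_measurable (restrict_space borel \<Theta> \<Otimes>\<^sub>M \<mu>)"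
  shows "(\<lambda>\<theta>. \<integral>\<^sup>+y. h \<theta> y \<partial>P \<theta>) \<in> borel_measurable (restrict_space borel \<Theta>)"
proof -
  note bimeasurable[measurable] h[measurable]
  have "(\<lambda>\<theta>. \<integral>\<^sup>+y. f \<theta> y * h \<theta> y \<partial>\<mu>) \<in> borel_measurable (restrict_space borel \<Theta>)"
    by measurable
  moreover have "(\<integral>\<^sup>+y. h \<theta> y \<partial>P \<theta>) = (\<integral>\<^sup>+y. f \<theta> y * h \<theta> y \<partial>\<mu>)"
    if "\<theta> \<in> space (restrict_space borel \<Theta>)" for \<theta>
  proof -
    have t: "\<theta> \<in> \<Theta>" using that by (simp add: space_restrict_space)
    have "(\<lambda>y. (\<theta>, y)) \<in> \<mu> \<rightarrow>\<^sub>M restrict_space borel \<Theta> \<Otimes>\<^sub>M \<mu>"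
      using that by (rule measurable_Pair1')
    from measurable_compose[OF this h] have "h \<theta> \<in> borel_measurable \<mu>" by simp
    then show ?thesis by (rule nn_integral_P[OF t])
  qed
  ultimately show ?thesis by (simp cong: measurable_cong)
qed

lemma measurable_param [measurable]: "(\<lambda>\<theta>. \<theta>) \<in> borel_measurable (restrict_space borel (\<Theta>::real set))"
  by (rule measurable_restrict_space1) simp

lemma measurable_point_risk:
  assumes [measurable]: "s \<in> borel_measurable \<mu>"
  shows "point_risk P s \<in> borel_measurable (restrict_space borel \<Theta>)"
proof -
  have [measurable]: "fst \<in> borel_measurable (restrict_space borel \<Theta> \<Otimes>\<^sub>M \<mu>)"
    using measurable_compose[OF measurable_fst measurable_param] by simp
  have "(\<lambda>(\<theta>, y). ennreal ((s y - \<theta>)\<^sup>2)) \<in> borel_measurable (restrict_space borel \<Theta> \<Otimes>\<^sub>M \<mu>)"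
    unfolding case_prod_beta by measurable
  from measurable_P_integral[OF this] show ?thesis
    unfolding point_risk_def .
qed

lemma of_nat_mult_nn_integral_empirical:
  assumes \<theta>: "\<theta> \<in> {..<n} \<rightarrow>\<^sub>E \<Theta>" and n: "n \<ge> 1"
    and h: "h \<in> borel_measurable (restrict_space borel \<Theta>)"
  shows "of_nat n * (\<integral>\<^sup>+x. h x \<partial>empirical \<Theta> n \<theta>) = (\<Sum>i<n. h (\<theta> i))"
proof -
  have c: "of_nat n * ennreal (1 / real n) = 1"
  proof -
    have "of_nat n * ennreal (1 / real n) = ennreal (real n) * ennreal (1 / real n)"
      by (simp only: ennreal_of_nat_eq_real_of_nat)
    also have "\<dots> = ennreal (real n * (1 / real n))"
      by (rule ennreal_mult[symmetric]) simp_all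
    also have "\<dots> = 1"
      using n by simp
    finally show ?thesis .
  qed
  have "(\<integral>\<^sup>+x. h x \<partial>empirical \<Theta> n \<theta>) = (\<integral>\<^sup>+i. h (\<theta> i) \<partial>uniform_count_measure {..<n})"
    unfolding empirical_def
    using h by (subst nn_integral_distr[OF measurable_uniform_count_measure[OF \<theta>]]) simp_all
  also have "\<dots> = (\<Sum>i<n. ennreal (1 / real n) * h (\<theta> i))"
    unfolding uniform_count_measure_def
    by (subst nn_integral_point_measure_finite) (simp_all)
  finally show ?thesis
    using c by (simp add: sum_distrib_left flip: mult.assoc)
qed

lemma of_nat_mult_mmse_empirical_le:
  assumes "\<theta> \<in> {..<n} \<rightarrow>\<^sub>E \<Theta>" "n \<ge> 1" "s \<in> borel_measurable \<mu>"
  shows "of_nat n * mmse \<mu> P (empirical \<Theta> n \<theta>) \<le> (\<Sum>i<n. point_risk P s (\<theta> i))"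
proof -
  have "of_nat n * mmse \<mu> P (empirical \<Theta> n \<theta>)
      \<le> of_nat n * (\<integral>\<^sup>+x. point_risk P s x \<partial>empirical \<Theta> n \<theta>)"
    by (intro mult_left_mono mmse_le assms) simp
  then show ?thesis
    by (simp add: of_nat_mult_nn_integral_empirical[OF assms(1,2) measurable_point_risk[OF assms(3)]])
qed

section \<open>Coordinatewise estimators and the oracle risk\<close>

text \<open>
  The squared Euclidean loss splits into coordinates, each still integrated against the joint law
  because the \<open>i\<close>-th estimate may use all observations.
\<close>

lemma risk_eq_sum:
  assumes \<theta>: "\<And>i. i < n \<Longrightarrow> \<theta> i \<in> \<Theta>" and t: "t \<in> estimators \<mu> n"
  shows "risk P n \<theta> t
    = (\<Sum>i<n. \<integral>\<^sup>+y. ennreal ((t y i - \<theta> i)\<^sup>2) \<partial>(\<Pi>\<^sub>M i\<in>{..<n}. P (\<theta> i)))"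
proof -
  have sets: "sets (\<Pi>\<^sub>M i\<in>{..<n}. P (\<theta> i)) = sets (\<Pi>\<^sub>M i\<in>{..<n}. \<mu>)"
    using \<theta> by (intro sets_PiM_cong) auto
  have comp: "(\<lambda>y. t y i) \<in> borel_measurable (\<Pi>\<^sub>M i\<in>{..<n}. P (\<theta> i))" if "i < n" for i
    unfolding measurable_cong_sets[OF sets refl]
    using measurable_compose[OF t[unfolded estimators_def] measurable_component_singleton[of i]] that
    by simp
  have "risk P n \<theta> t
      = (\<integral>\<^sup>+y. (\<Sum>i<n. ennreal ((t y i - \<theta> i)\<^sup>2)) \<partial>(\<Pi>\<^sub>M i\<in>{..<n}. P (\<theta> i)))"
    unfolding risk_def L2_set_def by (simp add: sum_nonneg)
  also have "\<dots> = (\<Sum>i<n. \<integral>\<^sup>+y. ennreal ((t y i - \<theta> i)\<^sup>2) \<partial>(\<Pi>\<^sub>M i\<in>{..<n}. P (\<theta> i)))"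
    using comp by (intro nn_integral_sum) auto
  finally show ?thesis .
qed

definition coordinatewise :: "nat \<Rightarrow> ('y \<Rightarrow> real) \<Rightarrow> (nat \<Rightarrow> 'y) \<Rightarrow> nat \<Rightarrow> real" where
  "coordinatewise n s y = (\<lambda>i\<in>{..<n}. s (y i))"

lemma coordinatewise_in_estimators:
  assumes [measurable]: "s \<in> borel_measurable \<mu>"
  shows "coordinatewise n s \<in> estimators \<mu> n"
  unfolding coordinatewise_def estimators_def by measurable

lemma risk_coordinatewise:
  assumes \<theta>: "\<And>i. i < n \<Longrightarrow> \<theta> i \<in> \<Theta>" and s: "s \<in> borel_measurable \<mu>"
  shows "risk P n \<theta> (coordinatewise n s) = (\<Sum>i<n. point_risk P s (\<theta> i))"
proof (subst risk_eq_sum[OF \<theta> coordinatewise_in_estimators[OF s]], assumption, rule sum.cong[OF refl])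
  fix i assume "i \<in> {..<n}"
  then have i: "i < n" by simp
  have meas: "(\<lambda>y. y i) \<in> (\<Pi>\<^sub>M i\<in>{..<n}. P (\<theta> i)) \<rightarrow>\<^sub>M P (\<theta> i)"
    using i by (intro measurable_component_singleton) simp
  have "(\<lambda>y. ennreal ((s y - \<theta> i)\<^sup>2)) \<in> borel_measurable (P (\<theta> i))"
    using s by (simp add: measurable_cong_sets[OF sets_P[OF \<theta>[OF i]] refl])
  then have "(\<integral>\<^sup>+y. ennreal ((s (y i) - \<theta> i)\<^sup>2) \<partial>(\<Pi>\<^sub>M i\<in>{..<n}. P (\<theta> i)))
     = (\<integral>\<^sup>+y. ennreal ((s y - \<theta> i)\<^sup>2) \<partial>distr (\<Pi>\<^sub>M i\<in>{..<n}. P (\<theta> i)) (P (\<theta> i)) (\<lambda>y. y i))"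
    by (subst nn_integral_distr[OF meas]) simp_all
  also have "\<dots> = point_risk P s (\<theta> i)"
    unfolding point_risk_def
    by (subst distr_PiM_component) (use i prob \<theta> in auto)
  finally show "(\<integral>\<^sup>+y. ennreal ((coordinatewise n s y i - \<theta> i)\<^sup>2) \<partial>(\<Pi>\<^sub>M i\<in>{..<n}. P (\<theta> i)))
      = point_risk P s (\<theta> i)"
    using i by (simp add: coordinatewise_def)
qed

text \<open>
  An estimator that applies the same \<open>s\<close> to every coordinate has the same risk at all permutations of
  \<open>\<theta>\<close>, so the supremum in the oracle risk costs it nothing.
\<close>

lemma oracle_risk_le_mmse:
  assumes \<theta>: "\<theta> \<in> {..<n} \<rightarrow>\<^sub>E \<Theta>" and n: "n \<ge> 1"
  shows "oracle_risk \<mu> P n \<theta> \<le> of_nat n * mmse \<mu> P (empirical \<Theta> n \<theta>)"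
proof (rule le_mult_mmse[OF n])
  fix s :: "'y \<Rightarrow> real" assume s: "s \<in> borel_measurable \<mu>"
  have "oracle_risk \<mu> P n \<theta>
      \<le> (SUP \<sigma>\<in>{\<sigma>. \<sigma> permutes {..<n}}. risk P n (\<theta> \<circ> \<sigma>) (coordinatewise n s))"
    unfolding oracle_risk_def by (rule INF_lower) (rule coordinatewise_in_estimators[OF s])
  also have "\<dots> \<le> (\<Sum>i<n. point_risk P s (\<theta> i))"
  proof (rule SUP_least)
    fix \<sigma> assume "\<sigma> \<in> {\<sigma>. \<sigma> permutes {..<n}}"
    then have \<sigma>: "\<sigma> permutes {..<n}" by simp
    have "(\<theta> \<circ> \<sigma>) i \<in> \<Theta>" if "i < n" for i
      using \<theta> permutes_in_image[OF \<sigma>, of i] that by (auto simp: PiE_iff)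
    then have "risk P n (\<theta> \<circ> \<sigma>) (coordinatewise n s) = (\<Sum>i<n. point_risk P s ((\<theta> \<circ> \<sigma>) i))"
      using s by (rule risk_coordinatewise)
    also have "\<dots> = (\<Sum>i<n. point_risk P s (\<theta> i))"
      using sum.permute[OF \<sigma>, of "\<lambda>i. point_risk P s (\<theta> i)"] by (simp add: o_def)
    finally show "risk P n (\<theta> \<circ> \<sigma>) (coordinatewise n s) \<le> (\<Sum>i<n. point_risk P s (\<theta> i))" by simp
  qed
  finally show "oracle_risk \<mu> P n \<theta> \<le> of_nat n * (\<integral>\<^sup>+x. point_risk P s x \<partial>empirical \<Theta> n \<theta>)"
    by (simp add: of_nat_mult_nn_integral_empirical[OF \<theta> n measurable_point_risk[OF s]])
qed

lemma tot_regret_comp_le_tot_regret_comp':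
  assumes "n \<ge> 1"
  shows "tot_regret_comp \<mu> P n \<Theta> \<le> tot_regret_comp' \<mu> P n \<Theta>"
  unfolding tot_regret_comp_def tot_regret_comp'_def
proof (rule INF_mono, rule bexI)
  fix t assume "t \<in> estimators \<mu> n"
  show "(SUP \<theta> \<in> {..<n} \<rightarrow>\<^sub>E \<Theta>.
        enn2ereal (risk P n \<theta> t) - enn2ereal (of_nat n * mmse \<mu> P (empirical \<Theta> n \<theta>)))
      \<le> (SUP \<theta> \<in> {..<n} \<rightarrow>\<^sub>E \<Theta>.
        enn2ereal (risk P n \<theta> t) - enn2ereal (oracle_risk \<mu> P n \<theta>))"
  proof (rule SUP_mono, rule bexI)
    fix \<theta> assume \<theta>: "\<theta> \<in> {..<n} \<rightarrow>\<^sub>E \<Theta>"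
    show "enn2ereal (risk P n \<theta> t) - enn2ereal (of_nat n * mmse \<mu> P (empirical \<Theta> n \<theta>))
        \<le> enn2ereal (risk P n \<theta> t) - enn2ereal (oracle_risk \<mu> P n \<theta>)"
      using oracle_risk_le_mmse[OF \<theta> assms]
      by (intro ereal_minus_mono) (simp_all add: less_eq_ennreal.rep_eq)
  qed
qed

end

section \<open>Perturbing an estimator towards an alternative\<close>

text \<open>
  Here \<open>v\<close> estimates well under \<open>A\<close>, where the truth is \<open>a\<close>, and under \<open>B\<close>, where the truth is \<open>b\<close>, it is
  almost as good as any \<open>w\<close> that is charged \<open>m\<close> times its risk under \<open>A\<close>. Let \<open>w\<close> move \<open>v\<close> a fraction \<open>\<epsilon>\<close> of
  the way to \<open>b\<close> on \<open>E\<close>. The gain under \<open>B\<close> is at least \<open>\<epsilon>\<close> times the squared error of \<open>v\<close> on \<open>E\<close>. By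
  \<open>dom\<close> this error is no smaller than the one with respect to \<open>A\<close>, where \<open>v\<close> is close to \<open>a\<close> and hence
  far from \<open>b\<close>, so it is at least
  about \<open>(b - a)\<^sup>2 A(E)\<close>. The risk of \<open>w\<close> under \<open>A\<close> is of order \<open>r + \<epsilon>\<^sup>2 (b - a)\<^sup>2 A(E)\<close>. For
  small \<open>\<epsilon>\<close> the quadratic term is absorbed, and \<open>(b - a)\<^sup>2 A(E)\<close> is at most a multiple of \<open>r\<close>.
\<close>

lemma perturbation_bound:
  fixes A B :: "'z measure" and v :: "'z \<Rightarrow> real" and a b r :: real and m :: nat
  assumes A: "prob_space A" and sets_B: "sets B = sets A"
    and E: "E \<in> sets A" and v: "v \<in> borel_measurable A" and r: "0 \<le> r"
    and own: "(\<integral>\<^sup>+z. ennreal ((v z - a)\<^sup>2) \<partial>A) \<le> ennreal r"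
    and finite: "(\<integral>\<^sup>+z. ennreal ((v z - b)\<^sup>2) \<partial>B) < \<infinity>"
    and mixed: "\<And>w. w \<in> borel_measurable A \<Longrightarrow> (\<integral>\<^sup>+z. ennreal ((v z - b)\<^sup>2) \<partial>B)
        \<le> ennreal r + of_nat m * (\<integral>\<^sup>+z. ennreal ((w z - a)\<^sup>2) \<partial>A)
          + (\<integral>\<^sup>+z. ennreal ((w z - b)\<^sup>2) \<partial>B)"
    and dom: "\<And>h. h \<in> borel_measurable A \<Longrightarrow>
        (\<integral>\<^sup>+z. h z * indicator E z \<partial>A) \<le> (\<integral>\<^sup>+z. h z * indicator E z \<partial>B)"
  shows "ennreal ((b - a)\<^sup>2) * emeasure A E \<le> ennreal (64 * (real m + 1)\<^sup>2 * r)"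
proof -
  interpret A: prob_space A by (rule A)
  note [measurable] = E v
  have [measurable]: "v \<in> borel_measurable B" "E \<in> sets B"
    using E v by (simp_all add: sets_B measurable_cong_sets[OF sets_B refl])
  \<comment> \<open>With this choice \<open>2 m \<epsilon>\<^sup>2\<close> is at most \<open>\<epsilon> / 4\<close>, half of the coefficient \<open>\<epsilon> / 2\<close> of the gain.\<close>
  define \<epsilon> where "\<epsilon> = 1 / (8 * (real m + 1))"
  have \<epsilon>: "0 < \<epsilon>" "\<epsilon> \<le> 1" "8 * (real m + 1) * \<epsilon> = 1"
    by (auto simp: \<epsilon>_def divide_simps)
  define c where "c = 2 * \<epsilon> - \<epsilon>\<^sup>2"
  have c: "\<epsilon> \<le> c" using \<epsilon> by (simp add: c_def power2_eq_square algebra_simps)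
  define w where "w z = v z + \<epsilon> * (b - v z) * indicator E z" for z
  have [measurable]: "w \<in> borel_measurable A" "w \<in> borel_measurable B"
    unfolding w_def by measurable
  define V where "V = (\<integral>\<^sup>+z. ennreal ((v z - b)\<^sup>2) \<partial>B)"
  define W where "W = (\<integral>\<^sup>+z. ennreal ((w z - b)\<^sup>2) \<partial>B)"
  define U where "U = (\<integral>\<^sup>+z. ennreal ((w z - a)\<^sup>2) \<partial>A)"
  define X where "X = (\<integral>\<^sup>+z. ennreal ((v z - b)\<^sup>2) * indicator E z \<partial>B)"
  define D where "D = ennreal ((b - a)\<^sup>2) * emeasure A E"
  have "X \<le> V" unfolding X_def V_def
    by (intro nn_integral_mono) (auto simp: indicator_def)
  \<comment> \<open>The gain \<open>V - W\<close> is exactly \<open>c\<close> times the squared error of \<open>v\<close> on \<open>E\<close>.\<close>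
  have V_split: "W + ennreal c * X = V"
  proof -
    have "W + ennreal c * X
        = (\<integral>\<^sup>+z. ennreal ((w z - b)\<^sup>2) + ennreal c * (ennreal ((v z - b)\<^sup>2) * indicator E z) \<partial>B)"
      unfolding W_def X_def by (simp add: nn_integral_add nn_integral_cmult)
    also have "\<dots> = V" unfolding V_def
    proof (rule nn_integral_cong)
      fix z
      show "ennreal ((w z - b)\<^sup>2) + ennreal c * (ennreal ((v z - b)\<^sup>2) * indicator E z)
          = ennreal ((v z - b)\<^sup>2)"
      proof (cases "z \<in> E")
        case True
        have "(w z - b)\<^sup>2 + c * (v z - b)\<^sup>2 = (v z - b)\<^sup>2"
          using True by (simp add: w_def c_def power2_eq_square algebra_simps)
        then show ?thesis
          using True c \<epsilon> by (simp flip: ennreal_mult ennreal_plus)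
      qed (simp add: w_def)
    qed
    finally show ?thesis .
  qed
  have U_le: "U \<le> 2 * ennreal r + ennreal (2 * \<epsilon>\<^sup>2) * D"
  proof -
    have "U \<le> (\<integral>\<^sup>+z. 2 * ennreal ((v z - a)\<^sup>2) + ennreal (2 * \<epsilon>\<^sup>2) * (ennreal ((b - a)\<^sup>2) * indicator E z) \<partial>A)"
      unfolding U_def
    proof (rule nn_integral_mono)
      fix z
      have "(w z - a)\<^sup>2 \<le> 2 * (v z - a)\<^sup>2 + 2 * \<epsilon>\<^sup>2 * ((b - a)\<^sup>2 * indicator E z)"
      proof (cases "z \<in> E")
        case True
        have "(w z - a)\<^sup>2 = ((1 - \<epsilon>) * (v z - a) + \<epsilon> * (b - a))\<^sup>2"
          using True by (simp add: w_def algebra_simps)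
        also have "\<dots> \<le> 2 * ((1 - \<epsilon>) * (v z - a))\<^sup>2 + 2 * (\<epsilon> * (b - a))\<^sup>2"
          using zero_le_power2[of "(1 - \<epsilon>) * (v z - a) - \<epsilon> * (b - a)"]
          by (simp add: power2_eq_square algebra_simps)
        also have "\<dots> \<le> 2 * (v z - a)\<^sup>2 + 2 * \<epsilon>\<^sup>2 * ((b - a)\<^sup>2 * indicator E z)"
        proof -
          have "(1 - \<epsilon>)\<^sup>2 \<le> 1" using \<epsilon> by (simp add: power_le_one)
          then have "(1 - \<epsilon>)\<^sup>2 * (v z - a)\<^sup>2 \<le> 1 * (v z - a)\<^sup>2"
            by (intro mult_right_mono) simp_all
          then show ?thesis using True by (simp add: power_mult_distrib)
        qed
        finally show ?thesis .
      next
        case False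
        then show ?thesis by (simp add: w_def)
      qed
      then have "ennreal ((w z - a)\<^sup>2)
          \<le> ennreal (2 * (v z - a)\<^sup>2 + 2 * \<epsilon>\<^sup>2 * ((b - a)\<^sup>2 * indicator E z))"
        by (rule ennreal_leI)
      also have "\<dots> = 2 * ennreal ((v z - a)\<^sup>2)
          + ennreal (2 * \<epsilon>\<^sup>2) * (ennreal ((b - a)\<^sup>2) * indicator E z)"
        by (simp add: ennreal_mult ennreal_indicator)
      finally show "ennreal ((w z - a)\<^sup>2) \<le> 2 * ennreal ((v z - a)\<^sup>2)
          + ennreal (2 * \<epsilon>\<^sup>2) * (ennreal ((b - a)\<^sup>2) * indicator E z)" .
    qed
    also have "\<dots> = 2 * (\<integral>\<^sup>+z. ennreal ((v z - a)\<^sup>2) \<partial>A) + ennreal (2 * \<epsilon>\<^sup>2) * D"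
      unfolding D_def by (simp add: nn_integral_add nn_integral_cmult)
    also have "\<dots> \<le> 2 * ennreal r + ennreal (2 * \<epsilon>\<^sup>2) * D"
      using own by (intro add_right_mono mult_left_mono) simp_all
    finally show ?thesis .
  qed
  have D_le: "D \<le> 2 * ennreal r + 2 * X"
  proof -
    have "D = (\<integral>\<^sup>+z. ennreal ((b - a)\<^sup>2) * indicator E z \<partial>A)"
      unfolding D_def by (simp add: nn_integral_cmult)
    also have "\<dots> \<le> (\<integral>\<^sup>+z. 2 * ennreal ((v z - a)\<^sup>2) + 2 * (ennreal ((v z - b)\<^sup>2) * indicator E z) \<partial>A)"
    proof (rule nn_integral_mono)
      fix z
      have "(b - a)\<^sup>2 * indicator E z \<le> 2 * (v z - a)\<^sup>2 + 2 * ((v z - b)\<^sup>2 * indicator E z)"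
      proof (cases "z \<in> E")
        case True
        then show ?thesis
          using zero_le_power2[of "(v z - a) + (v z - b)"]
          by (simp add: power2_eq_square algebra_simps)
      qed simp
      then have "ennreal ((b - a)\<^sup>2 * indicator E z)
          \<le> ennreal (2 * (v z - a)\<^sup>2 + 2 * ((v z - b)\<^sup>2 * indicator E z))"
        by (rule ennreal_leI)
      then show "ennreal ((b - a)\<^sup>2) * indicator E z
          \<le> 2 * ennreal ((v z - a)\<^sup>2) + 2 * (ennreal ((v z - b)\<^sup>2) * indicator E z)"
        by (simp add: ennreal_mult ennreal_indicator)
    qed
    also have "\<dots> = 2 * (\<integral>\<^sup>+z. ennreal ((v z - a)\<^sup>2) \<partial>A)
        + 2 * (\<integral>\<^sup>+z. ennreal ((v z - b)\<^sup>2) * indicator E z \<partial>A)"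
      by (simp add: nn_integral_add nn_integral_cmult)
    also have "\<dots> \<le> 2 * ennreal r + 2 * X"
      unfolding X_def using own by (intro add_mono mult_left_mono dom) simp_all
    finally show ?thesis .
  qed
  \<comment> \<open>Finiteness of \<open>V\<close> is what permits cancelling \<open>W\<close> from both sides of \<open>mixed\<close>.\<close>
  have "W \<le> V" using V_split by (metis le_iff_add)
  have "X < \<infinity>" "W < \<infinity>"
    using \<open>X \<le> V\<close> \<open>W \<le> V\<close> finite unfolding V_def by auto
  then obtain x w0 where x: "X = ennreal x" "0 \<le> x" and w0: "W = ennreal w0" "0 \<le> w0"
    by (metis ennreal_cases infinity_ennreal_def less_irrefl)
  have "D < \<infinity>"
    unfolding D_def by (simp add: ennreal_mult_eq_top_iff less_top[symmetric])
  then obtain d where d: "D = ennreal d" "0 \<le> d"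
    by (metis ennreal_cases infinity_ennreal_def less_irrefl)
  have 1: "d \<le> 2 * r + 2 * x"
  proof -
    have "ennreal d \<le> ennreal (2 * r + 2 * x)"
      using D_le r x d by (simp add: ennreal_mult)
    then show ?thesis using r x by (subst (asm) ennreal_le_iff) simp_all
  qed
  have 2: "w0 + c * x \<le> r + m * (2 * r + 2 * \<epsilon>\<^sup>2 * d) + w0"
  proof -
    have "W + ennreal c * X \<le> ennreal r + of_nat m * U + W"
      using mixed[of w] unfolding V_split unfolding V_def U_def W_def by simp
    also have "\<dots> \<le> ennreal r + of_nat m * (2 * ennreal r + ennreal (2 * \<epsilon>\<^sup>2) * D) + W"
      by (intro add_mono mult_left_mono U_le order_refl) simp_all
    also have "\<dots> = ennreal (r + m * (2 * r + 2 * \<epsilon>\<^sup>2 * d) + w0)"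
      using r d w0 by (simp add: ennreal_mult ennreal_of_nat_eq_real_of_nat)
    finally have "ennreal (w0 + c * x) \<le> ennreal (r + m * (2 * r + 2 * \<epsilon>\<^sup>2 * d) + w0)"
      using x w0 c \<epsilon> by (simp add: ennreal_mult)
    then show ?thesis
      using r d w0 by (subst (asm) ennreal_le_iff) simp_all
  qed
  have "d \<le> 64 * (real m + 1)\<^sup>2 * r"
  proof -
    have "\<epsilon> * (d / 2 - r) \<le> \<epsilon> * x"
      using 1 \<epsilon> by (intro mult_left_mono) simp_all
    also have "\<dots> \<le> c * x" using c x by (intro mult_right_mono) simp_all
    also have "\<dots> \<le> r + m * (2 * r + 2 * \<epsilon>\<^sup>2 * d)" using 2 by simp
    finally have 3: "\<epsilon> * (d / 2 - r) \<le> r + 2 * m * r + 2 * m * \<epsilon>\<^sup>2 * d"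
      by (simp add: algebra_simps)
    have "8 * real m * \<epsilon> \<le> 1" using \<epsilon> by (simp add: algebra_simps)
    then have "8 * real m * \<epsilon> * (\<epsilon> * d) \<le> 1 * (\<epsilon> * d)"
      using \<epsilon> d by (intro mult_right_mono) simp_all
    then have 4: "8 * (m * \<epsilon>\<^sup>2 * d) \<le> \<epsilon> * d"
      by (simp add: power2_eq_square algebra_simps)
    have 5: "\<epsilon> * r \<le> r" using \<epsilon> r by (simp add: mult_left_le_one_le)
    from 3 4 5 have "\<epsilon> * d \<le> 8 * (real m + 1) * r"
      by (simp add: algebra_simps)
    then have "8 * (real m + 1) * (\<epsilon> * d) \<le> 8 * (real m + 1) * (8 * (real m + 1) * r)"
      by (intro mult_left_mono) simp_all
    moreover have "8 * (real m + 1) * (\<epsilon> * d) = d"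
      using \<epsilon>(3) by (simp flip: mult.assoc)
    ultimately show ?thesis
      by (simp add: power2_eq_square algebra_simps)
  qed
  then show ?thesis
    using d unfolding D_def by (simp add: ennreal_leI)
qed

section \<open>Parameter vectors with one deviating coordinate\<close>

definition replicated :: "nat \<Rightarrow> 'y measure \<Rightarrow> (nat \<Rightarrow> 'y) measure" where
  "replicated m N = (\<Pi>\<^sub>M i\<in>{..<m}. N)"

text \<open>
  The last coordinate of \<open>t\<close> as a randomised estimator from one observation \<open>y\<close>: the other \<open>m\<close>
  observations \<open>q\<close> are the randomness.
\<close>

definition last_estimate :: "nat \<Rightarrow> ((nat \<Rightarrow> 'y) \<Rightarrow> nat \<Rightarrow> real) \<Rightarrow> (nat \<Rightarrow> 'y) \<times> 'y \<Rightarrow> real" where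
  "last_estimate m t = (\<lambda>(q, y). t (q(m := y)) m)"

definition last_deviates :: "nat \<Rightarrow> real \<Rightarrow> real \<Rightarrow> nat \<Rightarrow> real" where
  "last_deviates m a b = (\<lambda>i\<in>{..<Suc m}. if i < m then a else b)"

context parametric_family
begin

lemma prob_space_replicated: "a \<in> \<Theta> \<Longrightarrow> prob_space (replicated m (P a))"
  unfolding replicated_def by (intro prob_space_PiM prob)

lemma sets_replicated: "a \<in> \<Theta> \<Longrightarrow> sets (replicated m (P a)) = sets (\<Pi>\<^sub>M i\<in>{..<m}. \<mu>)"
  unfolding replicated_def by (intro sets_PiM_cong) auto

lemma sets_replicated_pair:
  "a \<in> \<Theta> \<Longrightarrow> b \<in> \<Theta> \<Longrightarrow>
    sets (replicated m (P a) \<Otimes>\<^sub>M P b) = sets ((\<Pi>\<^sub>M i\<in>{..<m}. \<mu>) \<Otimes>\<^sub>M \<mu>)"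
  by (intro sets_pair_measure_cong sets_replicated sets_P)

lemma last_estimate_measurable:
  assumes "t \<in> estimators \<mu> (Suc m)"
  shows "last_estimate m t \<in> borel_measurable ((\<Pi>\<^sub>M i\<in>{..<m}. \<mu>) \<Otimes>\<^sub>M \<mu>)"
proof -
  have "(\<lambda>y. t y m) \<in> borel_measurable (\<Pi>\<^sub>M i\<in>insert m {..<m}. \<mu>)"
    using measurable_compose[OF assms[unfolded estimators_def] measurable_component_singleton[of m]]
    by (simp add: lessThan_Suc)
  from measurable_compose[OF measurable_add_dim this] show ?thesis
    by (simp add: last_estimate_def case_prod_beta)
qed

text \<open>
  By independence the observations other than the last have law \<^term>\<open>replicated m (P a)\<close>, and the
  last coordinate contributes one nonnegative summand to the risk.
\<close>

lemma last_estimate_risk_le: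
  assumes a: "a \<in> \<Theta>" and b: "b \<in> \<Theta>" and t: "t \<in> estimators \<mu> (Suc m)"
  shows "(\<integral>\<^sup>+z. ennreal ((last_estimate m t z - b)\<^sup>2) \<partial>(replicated m (P a) \<Otimes>\<^sub>M P b))
      \<le> risk P (Suc m) (last_deviates m a b) t"
proof -
  define M where "M i = (if i < m then P a else P b)" for i
  have M: "prob_space (M i)" for i using prob a b by (simp add: M_def)
  interpret product_prob_space M "{..<Suc m}"
    using M by (intro product_prob_spaceI)
  interpret Pb: prob_space "P b" using prob b .
  let ?\<theta> = "last_deviates m a b"
  have \<theta>: "?\<theta> i \<in> \<Theta>" if "i < Suc m" for i using that a b by (simp add: last_deviates_def)
  have M_eq: "(\<Pi>\<^sub>M i\<in>{..<Suc m}. P (?\<theta> i)) = PiM (insert m {..<m}) M"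
    unfolding lessThan_Suc[symmetric]
    by (intro PiM_cong) (auto simp: M_def last_deviates_def)
  have sets_M: "sets (PiM (insert m {..<m}) M) = sets (\<Pi>\<^sub>M i\<in>{..<Suc m}. \<mu>)"
    unfolding lessThan_Suc using a b by (intro sets_PiM_cong) (auto simp: M_def)
  have t_meas: "(\<lambda>y. ennreal ((t y m - b)\<^sup>2)) \<in> borel_measurable (PiM (insert m {..<m}) M)"
    unfolding measurable_cong_sets[OF sets_M refl]
    using measurable_compose[OF t[unfolded estimators_def] measurable_component_singleton[of m]]
    by simp
  have M_le: "PiM {..<m} M = replicated m (P a)"
    unfolding replicated_def by (intro PiM_cong) (auto simp: M_def)
  have [measurable]: "last_estimate m t \<in> borel_measurable (replicated m (P a) \<Otimes>\<^sub>M P b)"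
    unfolding measurable_cong_sets[OF sets_replicated_pair[OF a b] refl]
    by (rule last_estimate_measurable[OF t])
  have "(\<integral>\<^sup>+z. ennreal ((last_estimate m t z - b)\<^sup>2) \<partial>(replicated m (P a) \<Otimes>\<^sub>M P b))
      = (\<integral>\<^sup>+q. \<integral>\<^sup>+y. ennreal ((last_estimate m t (q, y) - b)\<^sup>2) \<partial>P b \<partial>replicated m (P a))"
    by (rule Pb.nn_integral_fst[symmetric]) measurable
  also have "\<dots> = (\<integral>\<^sup>+y. ennreal ((t y m - b)\<^sup>2) \<partial>PiM (insert m {..<m}) M)"
    by (subst product_nn_integral_insert[OF _ _ t_meas])
      (simp_all add: M_le last_estimate_def, simp add: M_def)
  also have "\<dots> = (\<integral>\<^sup>+y. ennreal ((t y m - ?\<theta> m)\<^sup>2) \<partial>(\<Pi>\<^sub>M i\<in>{..<Suc m}. P (?\<theta> i)))"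
    unfolding M_eq by (simp add: last_deviates_def)
  also have "\<dots> \<le> risk P (Suc m) ?\<theta> t"
    by (subst risk_eq_sum[OF \<theta> t], assumption, rule member_le_sum[where f = "\<lambda>i. \<integral>\<^sup>+y. ennreal ((t y i - ?\<theta> i)\<^sup>2) \<partial>(\<Pi>\<^sub>M i\<in>{..<Suc m}. P (?\<theta> i))"])
     simp_all
  finally show ?thesis .
qed

lemma sum_last_deviates:
  "(\<Sum>i<Suc m. h (last_deviates m a b i)) = of_nat m * h a + (h b :: ennreal)"
  by (simp add: last_deviates_def)

lemma last_deviates_in: "a \<in> \<Theta> \<Longrightarrow> b \<in> \<Theta> \<Longrightarrow> last_deviates m a b \<in> {..<Suc m} \<rightarrow>\<^sub>E \<Theta>"
  by (simp add: last_deviates_def)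

lemma point_risk_const: "\<theta> \<in> \<Theta> \<Longrightarrow> point_risk P (\<lambda>_. c) \<theta> = ennreal ((c - \<theta>)\<^sup>2)"
  using prob_space.emeasure_space_1[OF prob] by (simp add: point_risk_def)

end

section \<open>Finite compound regret separates the parameters\<close>

text \<open>
  Compound regret at most \<open>r\<close> for an estimator of \<open>m + 1\<close> parameters, with the oracle's infimum
  unfolded into a comparison with every one-observation estimator \<open>s\<close>. This form avoids subtraction
  of extended reals and measurability of \<open>mmse(G\<^bsub>\<theta>\<^esub>)\<close> in \<open>\<theta>\<close>.
\<close>

locale bounded_regret = parametric_family \<mu> \<Theta> P f
  for \<mu> :: "'y measure" and \<Theta> P f +
  fixes m :: nat and t :: "(nat \<Rightarrow> 'y) \<Rightarrow> nat \<Rightarrow> real" and r :: real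
  assumes t: "t \<in> estimators \<mu> (Suc m)" and r: "0 \<le> r"
    and risk_le: "\<And>\<theta> s. \<theta> \<in> {..<Suc m} \<rightarrow>\<^sub>E \<Theta> \<Longrightarrow> s \<in> borel_measurable \<mu> \<Longrightarrow>
      risk P (Suc m) \<theta> t \<le> ennreal r + (\<Sum>i<Suc m. point_risk P s (\<theta> i))"
begin

lemma last_estimate_risk_le_compare:
  assumes a: "a \<in> \<Theta>" and b: "b \<in> \<Theta>" and s: "s \<in> borel_measurable \<mu>"
  shows "(\<integral>\<^sup>+z. ennreal ((last_estimate m t z - b)\<^sup>2) \<partial>(replicated m (P a) \<Otimes>\<^sub>M P b))
      \<le> ennreal r + of_nat m * point_risk P s a + point_risk P s b"
  using order_trans[OF last_estimate_risk_le[OF a b t] risk_le[OF last_deviates_in[OF a b] s]]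
  unfolding sum_last_deviates by (simp add: add.assoc)

text \<open>
  The left-hand side does not depend on the randomness, so the comparison with each realisation of
  \<open>w\<close> can be averaged. Randomised competitors are needed because the perturbation of
  \<^const>\<open>last_estimate\<close> is itself randomised.
\<close>

lemma last_estimate_risk_le_compare_randomized:
  assumes a: "a \<in> \<Theta>" and b: "b \<in> \<Theta>"
    and w: "w \<in> borel_measurable ((\<Pi>\<^sub>M i\<in>{..<m}. \<mu>) \<Otimes>\<^sub>M \<mu>)"
  shows "(\<integral>\<^sup>+z. ennreal ((last_estimate m t z - b)\<^sup>2) \<partial>(replicated m (P a) \<Otimes>\<^sub>M P b))
      \<le> ennreal r + of_nat m * (\<integral>\<^sup>+z. ennreal ((w z - a)\<^sup>2) \<partial>(replicated m (P a) \<Otimes>\<^sub>M P a))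
        + (\<integral>\<^sup>+z. ennreal ((w z - b)\<^sup>2) \<partial>(replicated m (P a) \<Otimes>\<^sub>M P b))"
    (is "?L \<le> _")
proof -
  let ?Q = "replicated m (P a)"
  interpret Q: prob_space ?Q by (rule prob_space_replicated[OF a])
  have slice: "(\<integral>\<^sup>+q. point_risk P (\<lambda>y. w (q, y)) c \<partial>?Q) = (\<integral>\<^sup>+z. ennreal ((w z - c)\<^sup>2) \<partial>(?Q \<Otimes>\<^sub>M P c))"
    and slice_meas: "(\<lambda>q. point_risk P (\<lambda>y. w (q, y)) c) \<in> borel_measurable ?Q"
    if c: "c \<in> \<Theta>" for c
  proof -
    interpret Pc: prob_space "P c" using prob c .
    have [measurable]: "w \<in> borel_measurable (?Q \<Otimes>\<^sub>M P c)"
      using w by (simp add: measurable_cong_sets[OF sets_replicated_pair[OF a c] refl])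
    show "(\<integral>\<^sup>+q. point_risk P (\<lambda>y. w (q, y)) c \<partial>?Q) = (\<integral>\<^sup>+z. ennreal ((w z - c)\<^sup>2) \<partial>(?Q \<Otimes>\<^sub>M P c))"
      unfolding point_risk_def by (rule Pc.nn_integral_fst) measurable
    show "(\<lambda>q. point_risk P (\<lambda>y. w (q, y)) c) \<in> borel_measurable ?Q"
      unfolding point_risk_def by measurable
  qed
  have "?L = (\<integral>\<^sup>+q. ?L \<partial>?Q)"
    by (simp add: Q.emeasure_space_1)
  also have "\<dots> \<le> (\<integral>\<^sup>+q. ennreal r + of_nat m * point_risk P (\<lambda>y. w (q, y)) a
      + point_risk P (\<lambda>y. w (q, y)) b \<partial>?Q)"
  proof (rule nn_integral_mono)
    fix q assume "q \<in> space ?Q"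
    then have "q \<in> space (\<Pi>\<^sub>M i\<in>{..<m}. \<mu>)"
      using sets_eq_imp_space_eq[OF sets_replicated[OF a]] by simp
    from measurable_compose[OF measurable_Pair1'[OF this] w]
    show "?L \<le> ennreal r + of_nat m * point_risk P (\<lambda>y. w (q, y)) a
      + point_risk P (\<lambda>y. w (q, y)) b"
      by (intro last_estimate_risk_le_compare a b)
  qed
  also have "\<dots> = ennreal r + of_nat m * (\<integral>\<^sup>+q. point_risk P (\<lambda>y. w (q, y)) a \<partial>?Q)
      + (\<integral>\<^sup>+q. point_risk P (\<lambda>y. w (q, y)) b \<partial>?Q)"
    using slice_meas[OF a] slice_meas[OF b]
    by (simp add: nn_integral_add nn_integral_cmult Q.emeasure_space_1)
  finally show ?thesis
    unfolding slice[OF a] slice[OF b] .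
qed

text \<open>
  The event \<open>E\<close> concerns the last observation only, and the law of the others is the same in both
  product measures. So on \<open>E\<close> the measure with last parameter \<open>b\<close> dominates the one with \<open>a\<close>, as \<open>perturbation_bound\<close> requires.
\<close>

lemma overlap_bound:
  assumes a: "a \<in> \<Theta>" and b: "b \<in> \<Theta>"
    and E: "E \<in> sets \<mu>" "\<And>y. y \<in> E \<Longrightarrow> f a y \<le> f b y"
  shows "ennreal ((b - a)\<^sup>2) * emeasure (P a) E \<le> ennreal (64 * (real m + 1)\<^sup>2 * r)"
proof -
  let ?Q = "replicated m (P a)" let ?S = "(\<Pi>\<^sub>M i\<in>{..<m}. \<mu>) \<Otimes>\<^sub>M \<mu>"
  let ?A = "?Q \<Otimes>\<^sub>M P a" and ?B = "?Q \<Otimes>\<^sub>M P b"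
  interpret Q: prob_space ?Q by (rule prob_space_replicated[OF a])
  interpret Pa: prob_space "P a" using prob a .
  interpret Pb: prob_space "P b" using prob b .
  note sets_A = sets_replicated_pair[OF a a] and sets_B = sets_replicated_pair[OF a b]
  note meas_A = measurable_cong_sets[OF sets_A refl] and meas_B = measurable_cong_sets[OF sets_B refl]
  let ?E = "space ?Q \<times> E"
  have E': "?E \<in> sets ?S"
    unfolding sets_A[symmetric] using E a by (intro pair_measureI) auto
  have "ennreal ((b - a)\<^sup>2) * emeasure ?A ?E \<le> ennreal (64 * (real m + 1)\<^sup>2 * r)"
  proof (rule perturbation_bound[where B = ?B and v = "last_estimate m t"])
    show "prob_space ?A" by (intro prob_space_pair Q.prob_space_axioms Pa.prob_space_axioms)
    show "sets ?B = sets ?A" by (simp add: sets_A sets_B)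
    show "?E \<in> sets ?A" using E' by (simp add: sets_A)
    show "last_estimate m t \<in> borel_measurable ?A"
      unfolding meas_A by (rule last_estimate_measurable[OF t])
    show "0 \<le> r" by (rule r)
    show "(\<integral>\<^sup>+z. ennreal ((last_estimate m t z - a)\<^sup>2) \<partial>?A) \<le> ennreal r"
      using last_estimate_risk_le_compare[OF a a, of "\<lambda>_. a"] a by (simp add: point_risk_const)
    have "(\<integral>\<^sup>+z. ennreal ((last_estimate m t z - b)\<^sup>2) \<partial>?B)
        \<le> ennreal r + of_nat m * ennreal ((b - a)\<^sup>2)"
      using last_estimate_risk_le_compare[OF a b, of "\<lambda>_. b"] a b by (simp add: point_risk_const)
    also have "\<dots> < \<infinity>"
      by (simp add: ennreal_mult_eq_top_iff less_top[symmetric])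
    finally show "(\<integral>\<^sup>+z. ennreal ((last_estimate m t z - b)\<^sup>2) \<partial>?B) < \<infinity>" .
  next
    fix w :: "(nat \<Rightarrow> 'y) \<times> 'y \<Rightarrow> real" assume "w \<in> borel_measurable ?A"
    then show "(\<integral>\<^sup>+z. ennreal ((last_estimate m t z - b)\<^sup>2) \<partial>?B)
        \<le> ennreal r + of_nat m * (\<integral>\<^sup>+z. ennreal ((w z - a)\<^sup>2) \<partial>?A)
          + (\<integral>\<^sup>+z. ennreal ((w z - b)\<^sup>2) \<partial>?B)"
      unfolding meas_A by (rule last_estimate_risk_le_compare_randomized[OF a b])
  next
    fix h :: "(nat \<Rightarrow> 'y) \<times> 'y \<Rightarrow> ennreal" assume h: "h \<in> borel_measurable ?A"
    have hE: "(\<lambda>z. h z * indicator ?E z) \<in> borel_measurable ?S"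
      using h E' unfolding meas_A by measurable
    have "(\<integral>\<^sup>+z. h z * indicator ?E z \<partial>?A) = (\<integral>\<^sup>+q. \<integral>\<^sup>+y. h (q, y) * indicator ?E (q, y) \<partial>P a \<partial>?Q)"
      using hE by (intro Pa.nn_integral_fst[symmetric]) (simp add: meas_A)
    also have "\<dots> \<le> (\<integral>\<^sup>+q. \<integral>\<^sup>+y. h (q, y) * indicator ?E (q, y) \<partial>P b \<partial>?Q)"
    proof (rule nn_integral_mono)
      fix q assume "q \<in> space ?Q"
      then have "q \<in> space (\<Pi>\<^sub>M i\<in>{..<m}. \<mu>)"
        using sets_eq_imp_space_eq[OF sets_replicated[OF a]] by simp
      from measurable_compose[OF measurable_Pair1'[OF this] hE]
      have meas: "(\<lambda>y. h (q, y) * indicator ?E (q, y)) \<in> borel_measurable \<mu>" .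
      show "(\<integral>\<^sup>+y. h (q, y) * indicator ?E (q, y) \<partial>P a) \<le> (\<integral>\<^sup>+y. h (q, y) * indicator ?E (q, y) \<partial>P b)"
        unfolding nn_integral_P[OF a meas] nn_integral_P[OF b meas]
        using E(2) by (intro nn_integral_mono) (auto simp: indicator_def intro: mult_right_mono)
    qed
    also have "\<dots> = (\<integral>\<^sup>+z. h z * indicator ?E z \<partial>?B)"
      using hE by (intro Pb.nn_integral_fst) (simp add: meas_B)
    finally show "(\<integral>\<^sup>+z. h z * indicator ?E z \<partial>?A) \<le> (\<integral>\<^sup>+z. h z * indicator ?E z \<partial>?B)" .
  qed
  moreover have "emeasure ?A ?E = emeasure (P a) E"
    using E(1) a by (subst Pa.emeasure_pair_measure_Times) (simp_all add: Q.emeasure_space_1)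
  ultimately show ?thesis by simp
qed

text \<open>
  The competitor is the likelihood ratio test between \<open>a\<close> and \<open>b\<close>. Both of its errors are covered by
  \<open>overlap_bound\<close>, applied once with the roles of \<open>a\<close> and \<open>b\<close> exchanged. The bound does not depend on \<open>b\<close>.
\<close>

lemma last_estimate_risk_bounded:
  assumes a: "a \<in> \<Theta>" and b: "b \<in> \<Theta>"
  shows "(\<integral>\<^sup>+z. ennreal ((last_estimate m t z - b)\<^sup>2) \<partial>(replicated m (P a) \<Otimes>\<^sub>M P b))
      \<le> ennreal r + of_nat (Suc m) * ennreal (64 * (real m + 1)\<^sup>2 * r)"
proof -
  note [measurable] = density_measurable[OF a] density_measurable[OF b]
  define E where "E = {y \<in> space \<mu>. f a y \<le> f b y}"
  define F where "F = {y \<in> space \<mu>. f b y < f a y}"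
  have [measurable]: "E \<in> sets \<mu>" "F \<in> sets \<mu>"
    unfolding E_def F_def by measurable
  define s where "s y = a + (b - a) * indicator E y" for y
  have s: "s \<in> borel_measurable \<mu>" unfolding s_def by measurable
  let ?C = "ennreal (64 * (real m + 1)\<^sup>2 * r)"
  have "point_risk P s a = (\<integral>\<^sup>+y. ennreal ((b - a)\<^sup>2) * indicator E y \<partial>P a)"
    unfolding point_risk_def by (intro nn_integral_cong) (auto simp: s_def indicator_def)
  also have "\<dots> = ennreal ((b - a)\<^sup>2) * emeasure (P a) E"
    using a by (intro nn_integral_cmult_indicator) simp
  also have "\<dots> \<le> ?C"
    by (rule overlap_bound[OF a b]) (auto simp: E_def)
  finally have sa: "point_risk P s a \<le> ?C" .
  have "point_risk P s b = (\<integral>\<^sup>+y. ennreal ((a - b)\<^sup>2) * indicator F y \<partial>P b)"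
    unfolding point_risk_def using sets_eq_imp_space_eq[OF sets_P[OF b]]
    by (intro nn_integral_cong) (auto simp: s_def E_def F_def indicator_def not_le)
  also have "\<dots> = ennreal ((a - b)\<^sup>2) * emeasure (P b) F"
    using b by (intro nn_integral_cmult_indicator) simp
  also have "\<dots> \<le> ?C"
    by (rule overlap_bound[OF b a]) (auto simp: F_def)
  finally have sb: "point_risk P s b \<le> ?C" .
  have "(\<integral>\<^sup>+z. ennreal ((last_estimate m t z - b)\<^sup>2) \<partial>(replicated m (P a) \<Otimes>\<^sub>M P b))
      \<le> ennreal r + of_nat m * point_risk P s a + point_risk P s b"
    by (rule last_estimate_risk_le_compare[OF a b s])
  also have "\<dots> \<le> ennreal r + of_nat m * ?C + ?C"
    using sa sb by (intro add_mono mult_left_mono order_refl) simp_all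
  finally show ?thesis by (simp add: algebra_simps)
qed

text \<open>
  Fix the other parameters at \<open>a\<close>. Every realisation of the randomised estimator bounds
  \<^const>\<open>mmse\<close>, hence so does their average, which by Fubini is an average over \<open>G\<close> of uniformly bounded risks.
\<close>

lemma mmse_finite:
  assumes G: "G \<in> priors \<Theta>" and a: "a \<in> \<Theta>"
  shows "mmse \<mu> P G < \<infinity>"
proof -
  interpret G: prob_space G using G by (simp add: priors_def)
  have sets_G: "sets G = sets (restrict_space borel \<Theta>)" using G by (simp add: priors_def)
  have space_G: "space G = \<Theta>"
    using sets_eq_imp_space_eq[OF sets_G] by (simp add: space_restrict_space)
  let ?Q = "replicated m (P a)" and ?S = "\<Pi>\<^sub>M i\<in>{..<m}. \<mu>" and ?T = "restrict_space borel \<Theta>"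
  let ?v = "last_estimate m t"
  interpret Q: prob_space ?Q by (rule prob_space_replicated[OF a])
  interpret QG: pair_sigma_finite G ?Q ..
  note [measurable] = last_estimate_measurable[OF t] bimeasurable
  have sets_QG: "sets (G \<Otimes>\<^sub>M ?Q) = sets (?T \<Otimes>\<^sub>M ?S)"
    by (intro sets_pair_measure_cong sets_G sets_replicated a)
  have slice: "(\<lambda>y. ?v (q, y)) \<in> borel_measurable \<mu>" if "q \<in> space ?Q" for q
  proof -
    have "q \<in> space ?S"
      using that sets_eq_imp_space_eq[OF sets_replicated[OF a]] by simp
    from measurable_compose[OF measurable_Pair1'[OF this] last_estimate_measurable[OF t]]
    show ?thesis .
  qed
  have joint: "(\<lambda>(\<theta>, q). point_risk P (\<lambda>y. ?v (q, y)) \<theta>) \<in> borel_measurable (G \<Otimes>\<^sub>M ?Q)"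
  proof -
    have [measurable]: "fst \<in> borel_measurable (?T \<Otimes>\<^sub>M ?S)"
      using measurable_compose[OF measurable_fst measurable_param] by simp
    have meas: "(\<lambda>x. \<integral>\<^sup>+y. f (fst x) y * ennreal ((?v (snd x, y) - fst x)\<^sup>2) \<partial>\<mu>)
        \<in> borel_measurable (?T \<Otimes>\<^sub>M ?S)"
      by measurable
    have eq: "point_risk P (\<lambda>y. ?v (snd x, y)) (fst x)
        = (\<integral>\<^sup>+y. f (fst x) y * ennreal ((?v (snd x, y) - fst x)\<^sup>2) \<partial>\<mu>)"
      if "x \<in> space (G \<Otimes>\<^sub>M ?Q)" for x
      unfolding point_risk_def
      using that slice[of "snd x"] by (intro nn_integral_P) (auto simp: space_pair_measure space_G)
    show ?thesis
      unfolding case_prod_beta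
      by (rule measurable_cong[THEN iffD2, OF eq])
        (use meas in \<open>simp_all only: measurable_cong_sets[OF sets_QG refl]\<close>)
  qed
  have "mmse \<mu> P G = (\<integral>\<^sup>+q. mmse \<mu> P G \<partial>?Q)"
    by (simp add: Q.emeasure_space_1)
  also have "\<dots> \<le> (\<integral>\<^sup>+q. \<integral>\<^sup>+\<theta>. point_risk P (\<lambda>y. ?v (q, y)) \<theta> \<partial>G \<partial>?Q)"
    by (intro nn_integral_mono mmse_le slice)
  also have "\<dots> = (\<integral>\<^sup>+\<theta>. \<integral>\<^sup>+q. point_risk P (\<lambda>y. ?v (q, y)) \<theta> \<partial>?Q \<partial>G)"
    using QG.Fubini'[OF joint] by simp
  also have "\<dots> \<le> (\<integral>\<^sup>+\<theta>. ennreal r + of_nat (Suc m) * ennreal (64 * (real m + 1)\<^sup>2 * r) \<partial>G)"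
  proof (rule nn_integral_mono)
    fix \<theta> assume "\<theta> \<in> space G"
    then have \<theta>: "\<theta> \<in> \<Theta>" by (simp add: space_G)
    interpret P\<theta>: prob_space "P \<theta>" using prob \<theta> .
    have [measurable]: "?v \<in> borel_measurable (?Q \<Otimes>\<^sub>M P \<theta>)"
      unfolding measurable_cong_sets[OF sets_replicated_pair[OF a \<theta>] refl]
      by (rule last_estimate_measurable[OF t])
    have "(\<integral>\<^sup>+q. point_risk P (\<lambda>y. ?v (q, y)) \<theta> \<partial>?Q)
        = (\<integral>\<^sup>+z. ennreal ((?v z - \<theta>)\<^sup>2) \<partial>(?Q \<Otimes>\<^sub>M P \<theta>))"
      unfolding point_risk_def by (rule P\<theta>.nn_integral_fst) measurable
    then show "(\<integral>\<^sup>+q. point_risk P (\<lambda>y. ?v (q, y)) \<theta> \<partial>?Q)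
        \<le> ennreal r + of_nat (Suc m) * ennreal (64 * (real m + 1)\<^sup>2 * r)"
      using last_estimate_risk_bounded[OF a \<theta>] by simp
  qed
  also have "\<dots> < \<infinity>"
    by (simp add: G.emeasure_space_1 ennreal_mult_eq_top_iff less_top[symmetric])
  finally show ?thesis .
qed

section \<open>From compound regret to Bayes regret\<close>

text \<open>
  The comparison is integrated for a fixed \<open>s\<close>, where it is linear in the marginals of \<open>\<theta>\<close>, and only
  then minimised over \<open>s\<close>. The concavity of \<^const>\<open>mmse\<close> in the prior thus enters as its being an
  infimum of linear functionals.
\<close>

lemma bayes_risk_le:
  assumes G: "G \<in> priors \<Theta>"
  shows "bayes_risk P (Suc m) G t \<le> ennreal r + of_nat (Suc m) * mmse \<mu> P G"
proof -
  interpret G: prob_space G using G by (simp add: priors_def)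
  have sets_G: "sets G = sets (restrict_space borel \<Theta>)" using G by (simp add: priors_def)
  have space_G: "space G = \<Theta>"
    using sets_eq_imp_space_eq[OF sets_G] by (simp add: space_restrict_space)
  let ?GG = "\<Pi>\<^sub>M i\<in>{..<Suc m}. G"
  interpret GG: prob_space ?GG by (intro prob_space_PiM G.prob_space_axioms)
  have bound: "bayes_risk P (Suc m) G t
      \<le> ennreal r + of_nat (Suc m) * (\<integral>\<^sup>+\<theta>. point_risk P s \<theta> \<partial>G)"
    if s: "s \<in> borel_measurable \<mu>" for s
  proof -
    have e: "point_risk P s \<in> borel_measurable G"
      using measurable_point_risk[OF s] by (simp add: measurable_cong_sets[OF sets_G refl])
    have comp: "(\<lambda>\<theta>. \<theta> i) \<in> ?GG \<rightarrow>\<^sub>M G" if "i < Suc m" for i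
      using that by (intro measurable_component_singleton) simp
    have "bayes_risk P (Suc m) G t \<le> (\<integral>\<^sup>+\<theta>. ennreal r + (\<Sum>i<Suc m. point_risk P s (\<theta> i)) \<partial>?GG)"
      unfolding bayes_risk_def
      by (intro nn_integral_mono risk_le s) (simp add: space_PiM space_G)
    also have "\<dots> = (\<integral>\<^sup>+\<theta>. ennreal r \<partial>?GG) + (\<integral>\<^sup>+\<theta>. (\<Sum>i<Suc m. point_risk P s (\<theta> i)) \<partial>?GG)"
      using measurable_compose[OF comp e]
      by (intro nn_integral_add borel_measurable_sum) auto
    also have "(\<integral>\<^sup>+\<theta>. (\<Sum>i<Suc m. point_risk P s (\<theta> i)) \<partial>?GG)
        = (\<Sum>i<Suc m. \<integral>\<^sup>+\<theta>. point_risk P s (\<theta> i) \<partial>?GG)"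
      using measurable_compose[OF comp e] by (intro nn_integral_sum) simp
    also have "\<dots> = (\<Sum>i<Suc m. \<integral>\<^sup>+\<theta>. point_risk P s \<theta> \<partial>G)"
    proof (rule sum.cong[OF refl])
      fix i assume "i \<in> {..<Suc m}"
      then have i: "i < Suc m" by simp
      have "(\<integral>\<^sup>+\<theta>. point_risk P s (\<theta> i) \<partial>?GG)
          = (\<integral>\<^sup>+\<theta>. point_risk P s \<theta> \<partial>distr ?GG G (\<lambda>\<theta>. \<theta> i))"
        using e by (subst nn_integral_distr[OF comp[OF i]]) simp_all
      also have "distr ?GG G (\<lambda>\<theta>. \<theta> i) = G"
        using i distr_PiM_component[of "{..<Suc m}" "\<lambda>_. G" i] G.prob_space_axioms by simp
      finally show "(\<integral>\<^sup>+\<theta>. point_risk P s (\<theta> i) \<partial>?GG) = (\<integral>\<^sup>+\<theta>. point_risk P s \<theta> \<partial>G)" .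
    qed
    finally show ?thesis by (simp add: GG.emeasure_space_1)
  qed
  have "bayes_risk P (Suc m) G t - ennreal r \<le> of_nat (Suc m) * mmse \<mu> P G"
  proof (rule le_mult_mmse)
    fix s :: "'y \<Rightarrow> real" assume "s \<in> borel_measurable \<mu>"
    from bound[OF this]
    show "bayes_risk P (Suc m) G t - ennreal r \<le> of_nat (Suc m) * (\<integral>\<^sup>+\<theta>. point_risk P s \<theta> \<partial>G)"
      by (simp add: ennreal_minus_le_iff)
  qed simp
  then show ?thesis by (simp add: ennreal_minus_le_iff)
qed

end

text \<open>
  Subtraction of extended reals can be undone when the subtrahend is finite; this is where
  \<open>mmse_finite\<close> enters.
\<close>

lemma ereal_regret_le_iff:
  fixes x y :: ennreal
  assumes "y < \<infinity>" "0 \<le> r"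
  shows "enn2ereal x - enn2ereal y \<le> ereal r \<longleftrightarrow> x \<le> ennreal r + y"
proof -
  obtain y' where y: "y = ennreal y'" "0 \<le> y'"
    using assms(1) by (cases y) auto
  show ?thesis
  proof (cases x)
    case (real x')
    have "x \<le> ennreal r + y \<longleftrightarrow> ennreal x' \<le> ennreal (r + y')"
      using real y assms(2) by simp
    also have "\<dots> \<longleftrightarrow> x' \<le> r + y'"
      using y assms(2) by (intro ennreal_le_iff) simp
    finally show ?thesis
      using real y by (simp add: diff_le_eq)
  qed (use y in \<open>auto simp: top_unique\<close>)
qed

context parametric_family
begin

lemma mmse_empirical_finite:
  assumes "\<theta> \<in> {..<n} \<rightarrow>\<^sub>E \<Theta>" "n \<ge> 1"
  shows "of_nat n * mmse \<mu> P (empirical \<Theta> n \<theta>) < \<infinity>"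
proof -
  have "of_nat n * mmse \<mu> P (empirical \<Theta> n \<theta>) \<le> (\<Sum>i<n. point_risk P (\<lambda>_. 0) (\<theta> i))"
    by (rule of_nat_mult_mmse_empirical_le[OF assms]) simp
  also have "\<dots> = (\<Sum>i<n. ennreal ((\<theta> i)\<^sup>2))"
    using assms(1) by (intro sum.cong refl) (simp add: point_risk_const PiE_iff)
  also have "\<dots> < \<infinity>" by simp
  finally show ?thesis .
qed


lemma tot_regret_le_tot_regret_comp:
  assumes n: "n \<ge> 1"
  shows "tot_regret \<mu> P n (priors \<Theta>) \<le> tot_regret_comp \<mu> P n \<Theta>"
  unfolding tot_regret_comp_def tot_regret_def
proof (rule INF_mono, rule bexI)
  fix t assume t: "t \<in> estimators \<mu> n"
  let ?R = "SUP \<theta> \<in> {..<n} \<rightarrow>\<^sub>E \<Theta>.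
        enn2ereal (risk P n \<theta> t) - enn2ereal (of_nat n * mmse \<mu> P (empirical \<Theta> n \<theta>))"
  show "(SUP G \<in> priors \<Theta>. enn2ereal (bayes_risk P n G t) - enn2ereal (of_nat n * mmse \<mu> P G)) \<le> ?R"
  proof (rule SUP_least)
    fix G assume G: "G \<in> priors \<Theta>"
    then interpret G: prob_space G by (simp add: priors_def)
    have "sets G = sets (restrict_space borel \<Theta>)" using G by (simp add: priors_def)
    from sets_eq_imp_space_eq[OF this] have "space G = \<Theta>"
      by (simp add: space_restrict_space)
    then obtain a where a: "a \<in> \<Theta>" using G.not_empty by auto
    obtain m where m: "n = Suc m" using n by (cases n) auto
    \<comment> \<open>On a constant vector the oracle makes no error, so the worst regret is nonnegative.\<close>
    define diag where "diag = (\<lambda>i\<in>{..<n}. a)"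
    have diag: "diag \<in> {..<n} \<rightarrow>\<^sub>E \<Theta>" using a by (simp add: diag_def)
    have "of_nat n * mmse \<mu> P (empirical \<Theta> n diag) \<le> (\<Sum>i<n. point_risk P (\<lambda>_. a) (diag i))"
      by (rule of_nat_mult_mmse_empirical_le[OF diag n]) simp
    also have "\<dots> = 0" using a by (simp add: diag_def point_risk_const)
    finally have "of_nat n * mmse \<mu> P (empirical \<Theta> n diag) = 0" by simp
    then have "enn2ereal (risk P n diag t) \<le> ?R"
      by (intro SUP_upper2[OF diag]) (simp del: mult_eq_0_iff add: zero_ennreal.rep_eq)
    then have R: "0 \<le> ?R" by (rule order_trans[OF enn2ereal_nonneg])
    show "enn2ereal (bayes_risk P n G t) - enn2ereal (of_nat n * mmse \<mu> P G) \<le> ?R"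
    proof (cases "?R = \<infinity>")
      case False
      define r where "r = real_of_ereal ?R"
      have r_nonneg: "0 \<le> r" and R_eq: "?R = ereal r"
        using R False by (auto simp: r_def real_of_ereal_pos ereal_real)
      have risk_le: "risk P n \<theta> t \<le> ennreal r + (\<Sum>i<n. point_risk P s (\<theta> i))"
        if \<theta>: "\<theta> \<in> {..<n} \<rightarrow>\<^sub>E \<Theta>" and s: "s \<in> borel_measurable \<mu>" for \<theta> s
      proof -
        have "enn2ereal (risk P n \<theta> t) - enn2ereal (of_nat n * mmse \<mu> P (empirical \<Theta> n \<theta>))
            \<le> ereal r"
          unfolding R_eq[symmetric] by (rule SUP_upper[OF \<theta>])
        then have "risk P n \<theta> t \<le> ennreal r + of_nat n * mmse \<mu> P (empirical \<Theta> n \<theta>)"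
          by (simp only: ereal_regret_le_iff[OF mmse_empirical_finite[OF \<theta> n] r_nonneg])
        also have "\<dots> \<le> ennreal r + (\<Sum>i<n. point_risk P s (\<theta> i))"
          by (intro add_left_mono of_nat_mult_mmse_empirical_le \<theta> n s)
        finally show ?thesis .
      qed
      interpret bounded_regret \<mu> \<Theta> P f m t r
        using t r_nonneg risk_le unfolding m by unfold_locales
      have "of_nat n * mmse \<mu> P G < \<infinity>"
        using mmse_finite[OF G a] by (simp add: ennreal_mult_eq_top_iff less_top[symmetric])
      then show ?thesis
        unfolding R_eq
        using bayes_risk_le[OF G] unfolding m by (subst ereal_regret_le_iff[OF _ r_nonneg])
    qed simp
  qed
qed

end

theorem proposition3:
  fixes \<mu> :: "'y measure"
    and \<Theta> :: "real set"
    and P :: "real \<Rightarrow> 'y measure"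
    and f :: "real \<Rightarrow> 'y \<Rightarrow> ennreal"
    and n :: nat
  assumes "parametric_family \<mu> \<Theta> P f"
    and "n \<ge> 1"
  shows "tot_regret_comp' \<mu> P n \<Theta> \<ge> tot_regret_comp \<mu> P n \<Theta> \<and>
    tot_regret_comp \<mu> P n \<Theta> \<ge> tot_regret \<mu> P n (priors \<Theta>)"
proof -
  interpret parametric_family \<mu> \<Theta> P f by (rule assms(1))
  show ?thesis
    using tot_regret_comp_le_tot_regret_comp' tot_regret_le_tot_regret_comp assms(2) by simp
qed

end
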